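(* Let $G$ be a Hausdorff topological group with identity $e$. Then $G$ is $\omega$-balanced and a $q$-space if and only if for each open neighborhood $O$ of $e$ in $G$ there is a countably compact invariant subgroup $H$ of $G$ which is of countable character in $G$, such that $H\subseteq O$, the canonical quotient mapping $p:G\rightarrow G/H$ is quasi-perfect, and the quotient group $G/H$ is metrizable.
   Context: All topological groups and spaces are assumed to be Hausdorff. "Invariant subgroup" means normal subgroup. For a subgroup $H$ of $G$, $G/H$ is the space of left cosets with the quotient topology, and $p:G\to G/H$ is the canonical quotient mapping. A topological group $G$ is $\omega$-balanced if for every neighbourhood $U$ of the identity $e$ there is a countable family $\gamma$ of open neighbourhoods of $e$ such that for each $x\in G$ there is $V\in\gamma$ with $xVx^{-1}\subseteq U$. A point $x$ of a space $X$ is a $q$-point if there is a sequence $\{U_n:n\in\omega\}$ of open neighborhoods of $x$ in $X$ such that every sequence $\{x_n\}_{n\in\omega}$ of points of $X$ with $x_n\in U_n$ for each $n\in\omega$ has a point of accumulation in $X$ (a point each of whose neighborhoods contains $x_n$ for infinitely many $n$). A space is a $q$-space if each of its points is a $q$-point. A subset $A$ of a space $X$ is of countable character in $X$ if there is a countable family $\{U_n:n\in\omega\}$ of open neighborhoods of $A$ (open sets containing $A$) such that each open neighborhood $U$ of $A$ contains some $U_n$. A set is countably compact if, as a subspace, every countable open cover of it has a finite subcover. A continuous mapping $f:X\to Y$ is quasi-perfect if $f$ is closed and $f^{-1}(y)$ is countably compact for each $y\in Y$. *)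

theory Defs
  imports "HOL-Analysis.Analysis" "HOL-Algebra.Left_Coset"
begin

locale topological_group = group G for G (structure) +
  fixes T :: "'a topology"
  assumes topspace_eq: "topspace T = carrier G"
    and continuous_mult: "continuous_map (prod_topology T T) T (\<lambda>(x, y). x \<otimes> y)"
    and continuous_inv: "continuous_map T T (\<lambda>x. inv x)"

text \<open>The finest topology on the image of \<open>f\<close> making \<open>f\<close> continuous.\<close>

definition quotient_topology :: "'a topology \<Rightarrow> ('a \<Rightarrow> 'b) \<Rightarrow> 'b topology" where
  "quotient_topology X f =
     topology (\<lambda>U. U \<subseteq> f ` topspace X \<and> openin X {x \<in> topspace X. f x \<in> U})"

lemma openin_quotient_topology:
  "openin (quotient_topology X f) U \<longleftrightarrow>
     U \<subseteq> f ` topspace X \<and> openin X {x \<in> topspace X. f x \<in> U}"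
proof -
  let ?L = "\<lambda>U. U \<subseteq> f ` topspace X \<and> openin X {x \<in> topspace X. f x \<in> U}"
  have "?L (S \<inter> S')" if "?L S" "?L S'" for S S'
  proof -
    have "{x \<in> topspace X. f x \<in> S \<inter> S'} =
        {x \<in> topspace X. f x \<in> S} \<inter> {x \<in> topspace X. f x \<in> S'}" by auto
    then show ?thesis using that by auto
  qed
  moreover have "?L (\<Union>\<K>)" if "\<forall>K\<in>\<K>. ?L K" for \<K>
  proof -
    have "{x \<in> topspace X. f x \<in> \<Union>\<K>} = (\<Union>K\<in>\<K>. {x \<in> topspace X. f x \<in> K})" by auto
    moreover have "openin X (\<Union>K\<in>\<K>. {x \<in> topspace X. f x \<in> K})"
      using that by (intro openin_Union) auto
    ultimately show ?thesis using that by auto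
  qed
  ultimately have "istopology ?L"
    unfolding istopology_def by blast
  then show ?thesis
    by (simp add: quotient_topology_def topology_inverse')
qed

lemma topspace_quotient_topology: "topspace (quotient_topology X f) = f ` topspace X"
proof
  show "topspace (quotient_topology X f) \<subseteq> f ` topspace X"
    using openin_topspace openin_quotient_topology by metis
  have "{x \<in> topspace X. f x \<in> f ` topspace X} = topspace X" by auto
  then show "f ` topspace X \<subseteq> topspace (quotient_topology X f)"
    by (intro openin_subset) (simp add: openin_quotient_topology)
qed

lemma quotient_map_quotient_topology: "quotient_map X (quotient_topology X f) f"
  by (auto simp: quotient_map_def topspace_quotient_topology openin_quotient_topology)

text \<open>The space \<open>G/H\<close> of left cosets; for normal \<open>H\<close> its points are those of the group
  \<open>G Mod H\<close>, although the latter is built from right cosets.\<close>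

definition coset_topology ::
  "('a, 'b) monoid_scheme \<Rightarrow> 'a topology \<Rightarrow> 'a set \<Rightarrow> 'a set topology" where
  "coset_topology G T H = quotient_topology T (\<lambda>x. x <#\<^bsub>G\<^esub> H)"

lemma (in topological_group) topspace_coset_topology:
  "topspace (coset_topology G T H) = lcosets H"
  by (auto simp: coset_topology_def topspace_quotient_topology topspace_eq LCOSETS_def)

lemma (in topological_group) topspace_coset_topology_normal:
  assumes "H \<lhd> G"
  shows "topspace (coset_topology G T H) = carrier (G Mod H)"
  using normal.coset_eq[OF assms]
  by (auto simp: topspace_coset_topology LCOSETS_def FactGroup_def RCOSETS_def)

definition omega_balanced :: "('a, 'b) monoid_scheme \<Rightarrow> 'a topology \<Rightarrow> bool" where
  "omega_balanced G T \<longleftrightarrow>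
     (\<forall>U\<subseteq>carrier G. (\<exists>W. openin T W \<and> \<one>\<^bsub>G\<^esub> \<in> W \<and> W \<subseteq> U) \<longrightarrow>
        (\<exists>\<gamma>. countable \<gamma> \<and> (\<forall>V\<in>\<gamma>. openin T V \<and> \<one>\<^bsub>G\<^esub> \<in> V) \<and>
             (\<forall>x\<in>carrier G. \<exists>V\<in>\<gamma>. (x <#\<^bsub>G\<^esub> V) #>\<^bsub>G\<^esub> (inv\<^bsub>G\<^esub> x) \<subseteq> U)))"

definition accumulation_point_of_seq :: "'a topology \<Rightarrow> (nat \<Rightarrow> 'a) \<Rightarrow> 'a \<Rightarrow> bool" where
  "accumulation_point_of_seq X s a \<longleftrightarrow>
     a \<in> topspace X \<and> (\<forall>W. openin X W \<and> a \<in> W \<longrightarrow> infinite {n. s n \<in> W})"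

definition q_point :: "'a topology \<Rightarrow> 'a \<Rightarrow> bool" where
  "q_point X x \<longleftrightarrow>
     (\<exists>U :: nat \<Rightarrow> 'a set. (\<forall>n. openin X (U n) \<and> x \<in> U n) \<and>
        (\<forall>s. (\<forall>n. s n \<in> U n) \<longrightarrow> (\<exists>a. accumulation_point_of_seq X s a)))"

definition q_space :: "'a topology \<Rightarrow> bool" where
  "q_space X \<longleftrightarrow> (\<forall>x\<in>topspace X. q_point X x)"

definition countable_character_in :: "'a topology \<Rightarrow> 'a set \<Rightarrow> bool" where
  "countable_character_in X A \<longleftrightarrow> A \<subseteq> topspace X \<and>
     (\<exists>U :: nat \<Rightarrow> 'a set. (\<forall>n. openin X (U n) \<and> A \<subseteq> U n) \<and>
        (\<forall>W. openin X W \<and> A \<subseteq> W \<longrightarrow> (\<exists>n. U n \<subseteq> W)))"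

definition countably_compact_space :: "'a topology \<Rightarrow> bool" where
  "countably_compact_space X \<longleftrightarrow>
     (\<forall>\<U>. countable \<U> \<and> (\<forall>U\<in>\<U>. openin X U) \<and> topspace X \<subseteq> \<Union>\<U> \<longrightarrow>
        (\<exists>\<F>\<subseteq>\<U>. finite \<F> \<and> topspace X \<subseteq> \<Union>\<F>))"

definition countably_compactin :: "'a topology \<Rightarrow> 'a set \<Rightarrow> bool" where
  "countably_compactin X S \<longleftrightarrow>
     S \<subseteq> topspace X \<and> countably_compact_space (subtopology X S)"

definition quasi_perfect_map :: "'a topology \<Rightarrow> 'b topology \<Rightarrow> ('a \<Rightarrow> 'b) \<Rightarrow> bool" where
  "quasi_perfect_map X Y f \<longleftrightarrow> continuous_map X Y f \<and> closed_map X Y f \<and>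
     (\<forall>y\<in>topspace Y. countably_compactin X {x \<in> topspace X. f x = y})"

end

(* Let U n witness that the identity is a q-point and let W be one of its neighbourhoods.
   Choose symmetric open V n inside W and U n with V (n+1) V (n+1) V (n+1) contained in V n,
   and use omega-balancedness to make every conjugate of a late V m lie inside V n.
   The intersection H of the V n is then a normal subgroup. Sequences with s n in V n
   accumulate in H, so H is countably compact and the V n form a base at H; this gives
   closedness of the quotient map, and Frink's chain construction applied to the V n
   metrizes G/H. Conversely, countable character together with x H x^-1 = H yields
   omega-balancedness, and every point of a countably compact set of countable character
   is a q-point. *)

theory Submission
  imports Defs
begin

section \<open>Pseudometrics from chains of relations\<close>

text \<open>A list is read as a walk through its entries. An infimum of such lengths satisfies the
  triangle inequality even when the weight \<open>f\<close> does not.\<close>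

fun walk_length :: "('a \<Rightarrow> 'a \<Rightarrow> real) \<Rightarrow> 'a list \<Rightarrow> real" where
  "walk_length f (u # v # vs) = f u v + walk_length f (v # vs)"
| "walk_length f vs = 0"

lemma walk_length_nonneg:
  assumes "\<And>x y. 0 \<le> f x y"
  shows "0 \<le> walk_length f vs"
  using assms by (induction f vs rule: walk_length.induct) (simp_all add: add_nonneg_nonneg)

lemma walk_length_append:
  assumes "us \<noteq> []" "vs \<noteq> []"
  shows "walk_length f (us @ vs) = walk_length f us + f (last us) (hd vs) + walk_length f vs"
  using assms
proof (induction f us rule: walk_length.induct)
  case ("2_2" f v)
  then show ?case by (cases vs) auto
qed auto

lemma walk_length_rev:
  assumes "\<And>x y. f x y = f y x"
  shows "walk_length f (rev vs) = walk_length f vs"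
proof (induction vs)
  case (Cons v vs)
  then show ?case
    by (cases vs) (simp_all add: walk_length_append[of "rev _ @ [_]" "[_]", simplified] assms)
qed simp

text \<open>Vertices move into the first piece until the remaining walk has length at most
  \<open>b\<close>. The edge at which the walk is cut counts for neither piece.\<close>

lemma walk_length_split:
  assumes "\<And>x y. 0 \<le> f x y" "2 \<le> length vs" "walk_length f vs \<le> a + b" "0 \<le> a" "0 \<le> b"
  shows "\<exists>ps qs. ps \<noteq> [] \<and> qs \<noteq> [] \<and> vs = ps @ qs \<and> walk_length f ps \<le> a \<and> walk_length f qs \<le> b"
  using assms(2-4)
proof (induction vs arbitrary: a)
  case (Cons u vs)
  then obtain v ws where vs: "vs = v # ws"
    by (cases vs) auto
  show ?case
  proof (cases "walk_length f vs \<le> b")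
    case True
    then show ?thesis
      using Cons.prems vs by (intro exI[of _ "[u]"] exI[of _ vs]) simp
  next
    case False
    \<comment> \<open>A remainder longer than \<open>b \<ge> 0\<close> still has an edge. The excess
      over \<open>b\<close> also forces \<open>f u v < a\<close>, so the budget
      \<open>a - f u v\<close> of the recursive call is not negative.\<close>
    then have "2 \<le> length vs"
      using vs \<open>0 \<le> b\<close> by (cases ws) auto
    moreover have "walk_length f vs \<le> (a - f u v) + b" "0 \<le> a - f u v"
      using Cons.prems(2) False vs by auto
    ultimately obtain ps qs where ps: "ps \<noteq> []" "qs \<noteq> []" "vs = ps @ qs"
        "walk_length f ps \<le> a - f u v" "walk_length f qs \<le> b"
      using Cons.IH by blast
    then have "walk_length f (u # ps) \<le> a"
      using vs by (cases ps) auto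
    then show ?thesis
      using ps by (intro exI[of _ "u # ps"] exI[of _ qs]) simp
  qed
qed simp

text \<open>A walk is cut at half its length; the three pieces (first half, middle edge, second half)
  then lie one level deeper.\<close>

lemma walk_in_relation:
  assumes nonneg: "\<And>x y. 0 \<le> f x y"
    and f_less: "\<And>n x y. f x y < (1/2) ^ n \<longleftrightarrow> (x, y) \<in> R n"
    and refl: "\<And>n. Id \<subseteq> R n"
    and comp: "\<And>n. R (Suc n) O R (Suc n) O R (Suc n) \<subseteq> R n"
    and "vs \<noteq> []" "walk_length f vs < (1/2) ^ Suc n"
  shows "(hd vs, last vs) \<in> R n"
  using assms(5,6)
proof (induction vs arbitrary: n rule: length_induct)
  case (1 vs)
  show ?case
  proof (cases "2 \<le> length vs")
    case False
    then have "hd vs = last vs"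
      using \<open>vs \<noteq> []\<close> by (cases vs) (auto simp: not_le)
    then show ?thesis
      using refl by auto
  next
    case True
    define s where "s = walk_length f vs"
    have "0 \<le> s"
      using nonneg by (simp add: s_def walk_length_nonneg)
    obtain ps qs where ps: "ps \<noteq> []" "qs \<noteq> []" "vs = ps @ qs"
        "walk_length f ps \<le> s/2" "walk_length f qs \<le> s/2"
      using walk_length_split[of f vs "s/2" "s/2", OF nonneg True] \<open>0 \<le> s\<close> by (auto simp: s_def)
    have "s/2 < (1/2) ^ Suc (Suc n)"
      using "1.prems" by (simp add: s_def)
    then have "(hd ps, last ps) \<in> R (Suc n)" "(hd qs, last qs) \<in> R (Suc n)"
      using "1.IH" ps by auto
    \<comment> \<open>The middle edge is bounded only by the full length \<open>s\<close>, but
      \<open>s < (1/2) ^ Suc n\<close> is just what \<open>f_less\<close> asks for at level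
      \<open>Suc n\<close>.\<close>
    moreover have "f (last ps) (hd qs) \<le> s"
      using walk_length_append[of ps qs f] ps walk_length_nonneg[of f, OF nonneg]
      by (simp add: s_def add.commute add_increasing)
    then have "(last ps, hd qs) \<in> R (Suc n)"
      using "1.prems" f_less[of "last ps" "hd qs" "Suc n"] by (simp add: s_def)
    ultimately show ?thesis
      using comp[of n] ps by auto
  qed
qed

text \<open>Frink's metrization argument: \<open>d\<close> is the infimum of walk lengths for a
  weight \<open>f\<close> that encodes the relations. The one-edge walk gives
  \<open>d \<le> f\<close> and hence the first estimate; \<open>walk_in_relation\<close> gives the
  second at the cost of one exponent.\<close>

lemma pseudometric_of_relations:
  fixes R :: "nat \<Rightarrow> 'a rel"
  assumes refl: "\<And>n. Id \<subseteq> R n"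
    and sym: "\<And>n. sym (R n)"
    and comp: "\<And>n. R (Suc n) O R (Suc n) O R (Suc n) \<subseteq> R n"
  obtains d :: "'a \<Rightarrow> 'a \<Rightarrow> real"
  where "\<And>x y. 0 \<le> d x y" "\<And>x. d x x = 0" "\<And>x y. d x y = d y x"
    "\<And>x y z. d x z \<le> d x y + d y z"
    "\<And>n x y. (x, y) \<in> R n \<Longrightarrow> d x y < (1/2) ^ n"
    "\<And>n x y. d x y < (1/2) ^ Suc n \<Longrightarrow> (x, y) \<in> R n"
proof -
  have "R (Suc n) \<subseteq> R n" for n
  proof clarify
    fix x y assume "(x, y) \<in> R (Suc n)"
    moreover have "(y, y) \<in> R (Suc n)"
      using refl by auto
    ultimately show "(x, y) \<in> R n"
      using comp[of n] by blast
  qed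
  then have anti: "R n \<subseteq> R m" if "m \<le> n" for m n
    using that by (rule lift_Suc_antimono_le)
  \<comment> \<open>The exponent is the first level that the pair fails to reach. As the relations
    decrease, \<open>f x y < (1/2) ^ n\<close> then expresses membership in \<open>R n\<close>
    exactly.\<close>
  define f :: "'a \<Rightarrow> 'a \<Rightarrow> real" where
    "f x y = (if \<forall>n. (x, y) \<in> R n then 0 else (1/2) ^ (LEAST n. (x, y) \<notin> R n))" for x y
  have f_nonneg: "0 \<le> f x y" for x y
    by (simp add: f_def)
  have f_refl: "f x x = 0" for x
    using refl by (auto simp: f_def)
  have "(x, y) \<in> R n \<longleftrightarrow> (y, x) \<in> R n" for x y n
    using sym[of n] by (auto dest: symD)
  then have f_sym: "f x y = f y x" for x y
    by (simp add: f_def)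
  have f_less: "f x y < (1/2) ^ n \<longleftrightarrow> (x, y) \<in> R n" for x y n
  proof (cases "\<forall>n. (x, y) \<in> R n")
    case False
    define l where "l = (LEAST n. (x, y) \<notin> R n)"
    have "(x, y) \<notin> R l"
      unfolding l_def by (rule LeastI_ex[of "\<lambda>n. (x, y) \<notin> R n"]) (use False in simp)
    moreover have "(x, y) \<in> R n" if "n < l" for n
      using not_less_Least[of n "\<lambda>n. (x, y) \<notin> R n"] that by (simp add: l_def)
    ultimately have "(x, y) \<in> R n \<longleftrightarrow> n < l"
      using anti[of l n] by (cases "n < l") (auto simp: not_less)
    moreover have "f x y = (1/2) ^ l"
      using False by (auto simp: f_def l_def)
    ultimately show ?thesis
      by (simp add: power_strict_decreasing_iff)
  qed (simp add: f_def)

  define S where "S x y = {walk_length f vs | vs. vs \<noteq> [] \<and> hd vs = x \<and> last vs = y}" for x y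
  define d where "d x y = Inf (S x y)" for x y
  have S_bdd: "bdd_below (S x y)" for x y
    using walk_length_nonneg[OF f_nonneg] by (intro bdd_belowI[of _ 0]) (auto simp: S_def)
  have edge: "f x y \<in> S x y" for x y
    by (force simp: S_def intro: exI[of _ "[x, y]"])
  then have S_nonempty: "S x y \<noteq> {}" for x y
    by blast
  have d_nonneg: "0 \<le> d x y" for x y
    unfolding d_def
    by (rule cInf_greatest[OF S_nonempty]) (auto simp: S_def walk_length_nonneg f_nonneg)
  have d_le_f: "d x y \<le> f x y" for x y
    unfolding d_def by (intro cInf_lower edge S_bdd)
  have "S x y \<subseteq> S y x" for x y
  proof
    fix t assume "t \<in> S x y"
    then obtain vs where "vs \<noteq> []" "hd vs = x" "last vs = y" "t = walk_length f vs"
      by (auto simp: S_def)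
    then show "t \<in> S y x"
      using walk_length_rev[of f vs, OF f_sym]
      by (auto simp: S_def hd_rev last_rev intro!: exI[of _ "rev vs"])
  qed
  then have "S x y = S y x" for x y
    by blast
  then have d_sym: "d x y = d y x" for x y
    by (simp add: d_def)
  have d_triangle: "d x z \<le> d x y + d y z" for x y z
  proof -
    have *: "d x z \<le> s + t" if st: "s \<in> S x y" "t \<in> S y z" for s t
    proof -
      obtain us vs where us: "us \<noteq> []" "hd us = x" "last us = y" "s = walk_length f us"
        and vs: "vs \<noteq> []" "hd vs = y" "last vs = z" "t = walk_length f vs"
        using st by (auto simp: S_def)
      \<comment> \<open>The joined walk visits \<open>y\<close> twice in a row; the edge between the
        two copies has weight \<open>f y y = 0\<close>.\<close>
      then have "walk_length f (us @ vs) = s + t"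
        by (simp add: walk_length_append f_refl)
      then have "s + t \<in> S x z"
        using us vs by (force simp: S_def intro: exI[of _ "us @ vs"])
      then show ?thesis
        unfolding d_def by (intro cInf_lower S_bdd)
    qed
    have "d x z - t \<le> d x y" if "t \<in> S y z" for t
      unfolding d_def[of x y]
      by (rule cInf_greatest[OF S_nonempty]) (use *[OF _ that] in \<open>simp add: algebra_simps\<close>)
    then have "d x z - d x y \<le> d y z"
      unfolding d_def[of y z]
      by (intro cInf_greatest[OF S_nonempty]) (simp add: algebra_simps)
    then show ?thesis by simp
  qed
  show thesis
  proof
    show "d x x = 0" for x
      using d_le_f[of x x] d_nonneg[of x x] f_refl[of x] by simp
    show "d x y < (1/2) ^ n" if "(x, y) \<in> R n" for n x y
      using that d_le_f[of x y] f_less[of x y n] by simp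
    show "(x, y) \<in> R n" if less: "d x y < (1/2) ^ Suc n" for n x y
    proof -
      obtain t where "t \<in> S x y" "t < (1/2) ^ Suc n"
        using cInf_lessD[OF S_nonempty less[unfolded d_def]] by blast
      then show ?thesis
        using walk_in_relation[of f R, OF f_nonneg f_less refl comp] by (auto simp: S_def)
    qed
  qed (fact d_nonneg d_sym d_triangle)+
qed


section \<open>Countable compactness and accumulation points\<close>

text \<open>If no initial part of an enumerated cover suffices, choose \<open>s n\<close> outside
  its first \<open>n + 1\<close> members. An accumulation point in \<open>S\<close> lies in some
  member \<open>U k\<close>, which would then contain a term \<open>s n\<close> with
  \<open>k \<le> n\<close>.\<close>

lemma countably_compactin_if_accumulation_points:
  assumes "S \<subseteq> topspace X"
    and acc: "\<And>s. range s \<subseteq> S \<Longrightarrow> \<exists>a\<in>S. accumulation_point_of_seq X s a"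
  shows "countably_compactin X S"
  unfolding countably_compactin_def countably_compact_space_def
proof (intro conjI allI impI assms(1))
  have top: "topspace (subtopology X S) = S"
    using assms(1) by auto
  fix \<U> assume "countable \<U> \<and> (\<forall>U\<in>\<U>. openin (subtopology X S) U) \<and>
    topspace (subtopology X S) \<subseteq> \<Union>\<U>"
  then have \<U>: "countable \<U>" "\<And>U. U \<in> \<U> \<Longrightarrow> openin (subtopology X S) U" "S \<subseteq> \<Union>\<U>"
    using top by auto
  show "\<exists>\<F>\<subseteq>\<U>. finite \<F> \<and> topspace (subtopology X S) \<subseteq> \<Union>\<F>"
  proof (rule ccontr)
    assume "\<not> ?thesis"
    then have no_cover: "\<not> S \<subseteq> \<Union>\<F>" if "\<F> \<subseteq> \<U>" "finite \<F>" for \<F>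
      using that top by auto
    then have "\<U> \<noteq> {}"
      using \<U>(3) by blast
    define U where "U = from_nat_into \<U>"
    have range_U: "range U = \<U>"
      using \<U>(1) \<open>\<U> \<noteq> {}\<close> by (simp add: U_def range_from_nat_into)
    have "\<exists>x. x \<in> S - \<Union>(U ` {..n})" for n
      using no_cover[of "U ` {..n}"] range_U by blast
    then obtain s where s: "\<And>n. s n \<in> S - \<Union>(U ` {..n})"
      by metis
    then obtain a where a: "a \<in> S" "accumulation_point_of_seq X s a"
      using acc[of s] by blast
    then obtain k where "a \<in> U k"
      using \<U>(3) range_U by blast
    obtain W where W: "openin X W" "U k = W \<inter> S"
      using \<U>(2)[of "U k"] range_U by (auto simp: openin_subtopology)
    have "infinite {n. s n \<in> W}"
      using a W \<open>a \<in> U k\<close> by (auto simp: accumulation_point_of_seq_def)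
    then obtain n where "k \<le> n" "s n \<in> W"
      by (metis infinite_nat_iff_unbounded_le mem_Collect_eq)
    then show False
      using s[of n] W(2) by blast
  qed
qed

text \<open>The sets \<open>S - F n\<close> form an increasing countable open cover of
  \<open>S\<close>, so the member of largest index in a finite subcover already covers
  \<open>S\<close>.\<close>

lemma countably_compactin_decreasing_closed:
  fixes F :: "nat \<Rightarrow> 'a set"
  assumes "countably_compactin X S"
    and closed: "\<And>n. closedin X (F n)" and "decseq F" and "S \<inter> (\<Inter>n. F n) = {}"
  obtains n where "S \<inter> F n = {}"
proof -
  have SX: "S \<subseteq> topspace X" and cc: "countably_compact_space (subtopology X S)"
    using assms(1) by (auto simp: countably_compactin_def)
  define U where "U n = S - F n" for n
  have "openin (subtopology X S) (U n)" for n
  proof -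
    have "U n = (topspace X - F n) \<inter> S"
      using SX by (auto simp: U_def)
    moreover have "openin X (topspace X - F n)"
      using closed by blast
    ultimately show ?thesis
      by (auto simp: openin_subtopology)
  qed
  moreover have "S \<subseteq> \<Union>(range U)"
    using assms(4) by (auto simp: U_def)
  ultimately obtain \<F> where \<F>: "\<F> \<subseteq> range U" "finite \<F>" "S \<subseteq> \<Union>\<F>"
    using cc[unfolded countably_compact_space_def, rule_format, of "range U"] SX
    by (auto simp: Int_absorb1)
  then obtain N where N: "finite N" "\<F> = U ` N"
    by (meson finite_subset_image)
  \<comment> \<open>Inserting \<open>0\<close> keeps the maximum meaningful when \<open>N\<close> is
    empty, in which case \<open>S\<close> is empty too.\<close>
  have "S \<inter> F (Max (insert 0 N)) = {}"
  proof -
    have "F (Max (insert 0 N)) \<subseteq> F n" if "n \<in> N" for n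
      by (rule decseqD[OF \<open>decseq F\<close>]) (simp add: that N(1))
    then show ?thesis
      using \<F>(3) N(2) unfolding U_def by blast
  qed
  then show thesis by (rule that)
qed

lemma countable_character_inE:
  assumes "countable_character_in X A"
  obtains U :: "nat \<Rightarrow> 'a set" where "\<And>n. openin X (U n)" "\<And>n. A \<subseteq> U n"
    "\<And>W. openin X W \<Longrightarrow> A \<subseteq> W \<Longrightarrow> \<exists>n. U n \<subseteq> W"
proof -
  obtain U :: "nat \<Rightarrow> 'a set" where U: "\<forall>n. openin X (U n) \<and> A \<subseteq> U n"
    "\<forall>W. openin X W \<and> A \<subseteq> W \<longrightarrow> (\<exists>n. U n \<subseteq> W)"
    using assms unfolding countable_character_in_def by (elim conjE exE)
  show thesis
    by (rule that[of U]) (use U in auto)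
qed

text \<open>If a selected sequence had no accumulation point, no point of \<open>S\<close> would lie
  in the closures of all its tails, and countable compactness would make one such closure miss
  \<open>S\<close>. The complement of that closure is a neighbourhood of \<open>S\<close>, so it
  contains some \<open>U m\<close>, yet \<open>U m\<close> contains all late terms.\<close>

lemma q_point_of_countable_character:
  assumes cc: "countably_compactin X S" and "countable_character_in X S" and "x \<in> S"
  shows "q_point X x"
proof -
  have SX: "S \<subseteq> topspace X"
    using cc by (simp add: countably_compactin_def)
  obtain U :: "nat \<Rightarrow> 'a set" where U: "\<And>n. openin X (U n)" "\<And>n. S \<subseteq> U n"
    and base: "\<And>W. openin X W \<Longrightarrow> S \<subseteq> W \<Longrightarrow> \<exists>n. U n \<subseteq> W"
    by (rule countable_character_inE[OF assms(2)]) blast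
  \<comment> \<open>Finite intersections make the sequence decreasing, so that \<open>s n\<close>
    lies in \<open>U m\<close> for every \<open>n \<ge> m\<close>.\<close>
  define V where "V n = (\<Inter>k\<le>n. U k)" for n
  have "openin X (V n) \<and> x \<in> V n" for n
    using U \<open>x \<in> S\<close> by (auto simp: V_def intro!: openin_INT2)
  moreover have "\<exists>a. accumulation_point_of_seq X s a" if s: "\<And>n. s n \<in> V n" for s
  proof (rule ccontr)
    assume no_acc: "\<not> ?thesis"
    define F where "F n = X closure_of (s ` {n..})" for n
    have "S \<inter> (\<Inter>n. F n) = {}"
    proof (rule ccontr)
      assume "S \<inter> (\<Inter>n. F n) \<noteq> {}"
      then obtain a where a: "a \<in> S" "\<And>n. a \<in> F n"
        by auto
      have "infinite {n. s n \<in> W}" if "openin X W" "a \<in> W" for W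
        unfolding infinite_nat_iff_unbounded_le
      proof
        fix m
        have "\<exists>y\<in>s ` {m..}. y \<in> W"
          using a(2)[of m] that unfolding F_def in_closure_of by blast
        then show "\<exists>n\<ge>m. n \<in> {n. s n \<in> W}"
          by auto
      qed
      then show False
        using no_acc a(1) SX by (auto simp: accumulation_point_of_seq_def)
    qed
    moreover have "decseq F"
      unfolding F_def decseq_def by (intro allI impI closure_of_mono image_mono) auto
    ultimately obtain n where n: "S \<inter> F n = {}"
      using countably_compactin_decreasing_closed[OF cc, of F] by (auto simp: F_def)
    have "openin X (topspace X - F n)"
      by (auto simp: F_def)
    then obtain m where m: "U m \<subseteq> topspace X - F n"
      using base n SX by blast
    \<comment> \<open>The index \<open>max m n\<close> is late enough both for \<open>U m\<close>
      and for the tail that starts at \<open>n\<close>.\<close>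
    have "s (max m n) \<in> U m"
      using s[of "max m n"] by (auto simp: V_def)
    moreover have "s (max m n) \<in> F n"
    proof -
      have "range s \<subseteq> topspace X"
        using s U(1) openin_subset by (fastforce simp: V_def)
      then have "s ` {n..} \<subseteq> F n"
        unfolding F_def by (intro closure_of_subset) auto
      then show ?thesis by auto
    qed
    ultimately show False
      using m by blast
  qed
  ultimately show ?thesis
    unfolding q_point_def by blast
qed


section \<open>Translations and small neighbourhoods\<close>

context topological_group
begin

lemma openin_subset_carrier: "openin T U \<Longrightarrow> U \<subseteq> carrier G"
  using openin_subset topspace_eq by blast

lemma mult_inv_cancel: "x \<in> carrier G \<Longrightarrow> y \<in> carrier G \<Longrightarrow> x \<otimes> (inv x \<otimes> y) = y"
  by (simp add: m_assoc[symmetric])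

lemma continuous_map_mult:
  assumes "continuous_map X T f" "continuous_map X T g"
  shows "continuous_map X T (\<lambda>x. f x \<otimes> g x)"
  using continuous_map_compose[OF continuous_map_pairedI[OF assms] continuous_mult]
  by (simp add: o_def)

lemma openin_left_translate:
  assumes "openin T U" "x \<in> carrier G"
  shows "openin T {y \<in> carrier G. x \<otimes> y \<in> U}"
proof -
  have "continuous_map T T (\<lambda>y. x \<otimes> y)"
    using assms(2) by (intro continuous_map_mult) (auto simp: topspace_eq)
  from openin_continuous_map_preimage[OF this assms(1)] show ?thesis
    by (simp add: topspace_eq)
qed

lemma openin_conjugate:
  assumes "openin T U" "x \<in> carrier G"
  shows "openin T {y \<in> carrier G. x \<otimes> y \<otimes> inv x \<in> U}"
proof -
  have "continuous_map T T (\<lambda>y. x \<otimes> y \<otimes> inv x)"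
    using assms(2) by (intro continuous_map_mult) (auto simp: topspace_eq)
  from openin_continuous_map_preimage[OF this assms(1)] show ?thesis
    by (simp add: topspace_eq)
qed

text \<open>Left translation by \<open>x\<close> is a homeomorphism. This carries accumulation from
  the identity to other points and from a subgroup to its cosets.\<close>

lemma accumulation_point_translate:
  assumes "x \<in> carrier G" "\<And>n. s n \<in> carrier G"
    and "accumulation_point_of_seq T (\<lambda>n. inv x \<otimes> s n) a"
  shows "accumulation_point_of_seq T s (x \<otimes> a)"
  unfolding accumulation_point_of_seq_def
proof (intro conjI allI impI)
  have a: "a \<in> carrier G"
    using assms(3) by (simp add: accumulation_point_of_seq_def topspace_eq)
  then show "x \<otimes> a \<in> topspace T"
    using assms(1) by (simp add: topspace_eq)
  fix W assume W: "openin T W \<and> x \<otimes> a \<in> W"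
  define W' where "W' = {y \<in> carrier G. x \<otimes> y \<in> W}"
  have "openin T W'" "a \<in> W'"
    using W a assms(1) by (auto simp: W'_def intro: openin_left_translate)
  then have "infinite {n. inv x \<otimes> s n \<in> W'}"
    using assms(3) by (simp add: accumulation_point_of_seq_def)
  moreover have "inv x \<otimes> s n \<in> W' \<longleftrightarrow> s n \<in> W" for n
    using assms(1,2) by (simp add: W'_def inv_solve_left m_assoc[symmetric])
  ultimately show "infinite {n. s n \<in> W}"
    by simp
qed

text \<open>A topological group is homogeneous: translating the neighbourhoods that witness the
  property at the identity gives witnesses at every point.\<close>

lemma q_space_iff_q_point_one: "q_space T \<longleftrightarrow> q_point T \<one>"
proof
  assume "q_point T \<one>"
  then obtain U where U: "\<And>n. openin T (U n)" "\<And>n. \<one> \<in> U n"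
    and acc: "\<And>s. \<forall>n. s n \<in> U n \<Longrightarrow> \<exists>a. accumulation_point_of_seq T s a"
    by (auto simp: q_point_def)
  show "q_space T"
    unfolding q_space_def topspace_eq
  proof
    fix x assume x: "x \<in> carrier G"
    define U' where "U' n = {y \<in> carrier G. inv x \<otimes> y \<in> U n}" for n
    have "openin T (U' n) \<and> x \<in> U' n" for n
      using U x by (auto simp: U'_def intro: openin_left_translate)
    moreover have "\<exists>a. accumulation_point_of_seq T s a" if "\<forall>n. s n \<in> U' n" for s
      using acc[of "\<lambda>n. inv x \<otimes> s n"] that accumulation_point_translate[OF x, of s]
      by (auto simp: U'_def)
    ultimately show "q_point T x"
      unfolding q_point_def by blast
  qed
qed (simp add: q_space_def topspace_eq)

text \<open>Continuity of the product at the identity is applied twice. For \<open>x\<close>,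
  \<open>y\<close>, \<open>z\<close> in \<open>A \<inter> B\<close> both
  \<open>x \<otimes> y\<close> and \<open>z\<close> lie in \<open>A\<close>, so the triple product
  lies in \<open>U\<close>; intersecting with the inverse set gives symmetry.\<close>

lemma symmetric_cube_neighbourhood:
  assumes "openin T U" "\<one> \<in> U"
  obtains W where "openin T W" "\<one> \<in> W" "\<And>x. x \<in> W \<Longrightarrow> inv x \<in> W"
    "\<And>x y z. x \<in> W \<Longrightarrow> y \<in> W \<Longrightarrow> z \<in> W \<Longrightarrow> x \<otimes> y \<otimes> z \<in> U"
proof -
  have square: "\<exists>A. openin T A \<and> \<one> \<in> A \<and> (\<forall>x\<in>A. \<forall>y\<in>A. x \<otimes> y \<in> X)"
    if X: "openin T X" "\<one> \<in> X" for X
  proof -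
    have "openin (prod_topology T T) {p \<in> topspace (prod_topology T T). (\<lambda>(x, y). x \<otimes> y) p \<in> X}"
      by (rule openin_continuous_map_preimage[OF continuous_mult X(1)])
    moreover have "(\<one>, \<one>) \<in> {p \<in> topspace (prod_topology T T). (\<lambda>(x, y). x \<otimes> y) p \<in> X}"
      using X by (simp add: topspace_eq)
    ultimately obtain A B where AB: "openin T A" "openin T B" "\<one> \<in> A" "\<one> \<in> B"
      "A \<times> B \<subseteq> {p \<in> topspace (prod_topology T T). (\<lambda>(x, y). x \<otimes> y) p \<in> X}"
      unfolding openin_prod_topology_alt by meson
    then show ?thesis
      by (intro exI[of _ "A \<inter> B"]) auto
  qed
  obtain A where A: "openin T A" "\<one> \<in> A" "\<And>x y. x \<in> A \<Longrightarrow> y \<in> A \<Longrightarrow> x \<otimes> y \<in> U"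
    using square[OF assms] by blast
  obtain B where B: "openin T B" "\<one> \<in> B" "\<And>x y. x \<in> B \<Longrightarrow> y \<in> B \<Longrightarrow> x \<otimes> y \<in> A"
    using square[OF A(1,2)] by blast
  define C where "C = A \<inter> B"
  define W where "W = C \<inter> {x \<in> carrier G. inv x \<in> C}"
  have C: "openin T C"
    using A B by (auto simp: C_def)
  have "openin T {x \<in> carrier G. inv x \<in> C}"
    using openin_continuous_map_preimage[OF continuous_inv C] by (simp add: topspace_eq)
  then have "openin T W"
    using C by (auto simp: W_def)
  then show thesis
    using A B by (intro that[of W]) (auto simp: W_def C_def)
qed

text \<open>This form of coset equality can be compared directly with conditions
  \<open>inv x \<otimes> y \<in> V n\<close>.\<close>

lemma l_coset_eq_iff:
  assumes "subgroup H G" "x \<in> carrier G" "y \<in> carrier G"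
  shows "x <# H = y <# H \<longleftrightarrow> inv x \<otimes> y \<in> H"
proof
  assume "x <# H = y <# H"
  then have "y \<in> x <# H"
    using lcos_self assms by blast
  then show "inv x \<otimes> y \<in> H"
    using assms subgroup.lcos_module_imp[OF assms(1)] is_group by blast
next
  assume "inv x \<otimes> y \<in> H"
  moreover have "y = x \<otimes> (inv x \<otimes> y)"
    using assms by (simp add: m_assoc[symmetric])
  ultimately have "y \<in> x <# H"
    unfolding l_coset_def by blast
  then show "x <# H = y <# H"
    using assms l_repr_independence by blast
qed

end


section \<open>The subgroup cut out by a sequence of neighbourhoods\<close>

text \<open>The triple product mirrors the triple composition in
  \<open>pseudometric_of_relations\<close>: the relations \<open>inv x \<otimes> y \<in> V n\<close>
  will satisfy its hypotheses on the carrier.\<close>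

locale neighbourhood_sequence = topological_group G T for G (structure) and T +
  fixes V :: "nat \<Rightarrow> 'a set"
  assumes V_open: "openin T (V n)"
    and V_one: "\<one> \<in> V n"
    and V_inv: "x \<in> V n \<Longrightarrow> inv x \<in> V n"
    and V_mult3: "\<lbrakk>x \<in> V (Suc n); y \<in> V (Suc n); z \<in> V (Suc n)\<rbrakk> \<Longrightarrow> x \<otimes> y \<otimes> z \<in> V n"
begin

lemma V_carrier: "x \<in> V n \<Longrightarrow> x \<in> carrier G"
  using openin_subset_carrier[OF V_open] by blast

lemma V_mult: "\<lbrakk>x \<in> V (Suc n); y \<in> V (Suc n)\<rbrakk> \<Longrightarrow> x \<otimes> y \<in> V n"
  using V_mult3[of x n y \<one>] V_one V_carrier by simp

lemma V_antimono: "m \<le> n \<Longrightarrow> V n \<subseteq> V m"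
proof (rule lift_Suc_antimono_le)
  show "V (Suc n) \<subseteq> V n" for n
    using V_mult[of _ n \<one>] V_one V_carrier by fastforce
qed

definition core :: "'a set" where
  "core = (\<Inter>n. V n)"

lemma core_subset: "core \<subseteq> V n"
  by (auto simp: core_def)

lemma subgroup_core: "subgroup core G"
proof (rule subgroupI)
  show "core \<subseteq> carrier G"
    using V_carrier by (auto simp: core_def)
  have "\<one> \<in> core"
    using V_one by (simp add: core_def)
  then show "core \<noteq> {}"
    by blast
  show "inv x \<in> core" if "x \<in> core" for x
    using that V_inv by (auto simp: core_def)
  show "x \<otimes> y \<in> core" if "x \<in> core" "y \<in> core" for x y
    using that V_mult by (auto simp: core_def)
qed

text \<open>Some late term has the form \<open>s n = a \<otimes> v\<close> with \<open>v\<close> in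
  \<open>V (Suc m)\<close>. Then \<open>a = s n \<otimes> inv v\<close> is a product of two elements
  of \<open>V (Suc m)\<close>.\<close>

lemma mem_V_if_frequently_near:
  assumes "accumulation_point_of_seq T s a" "\<And>n. k \<le> n \<Longrightarrow> s n \<in> V (Suc m)"
  shows "a \<in> V m"
proof -
  have a: "a \<in> carrier G"
    using assms(1) by (simp add: accumulation_point_of_seq_def topspace_eq)
  define W where "W = {y \<in> carrier G. inv a \<otimes> y \<in> V (Suc m)}"
  have "openin T W" "a \<in> W"
    using a V_open V_one by (auto simp: W_def intro: openin_left_translate)
  then have "infinite {n. s n \<in> W}"
    using assms(1) by (simp add: accumulation_point_of_seq_def)
  then obtain n where n: "k \<le> n" "s n \<in> W"
    by (metis infinite_nat_iff_unbounded_le mem_Collect_eq)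
  then have "s n \<otimes> inv (inv a \<otimes> s n) \<in> V m"
    using assms(2) V_inv by (intro V_mult) (auto simp: W_def)
  then show ?thesis
    using a n(2) by (simp add: W_def inv_mult_group m_assoc[symmetric])
qed

end

section \<open>Neighbourhood sequences whose selections accumulate\<close>

locale q_neighbourhood_sequence = neighbourhood_sequence +
  assumes V_acc: "\<forall>n. s n \<in> V n \<Longrightarrow> \<exists>a. accumulation_point_of_seq T s a"
begin

text \<open>From index \<open>Suc m\<close> on, all terms lie in \<open>V (Suc m)\<close>, which
  puts any accumulation point into \<open>V m\<close>, for every \<open>m\<close>.\<close>

lemma accumulation_point_in_core:
  assumes "\<forall>n. s n \<in> V n"
  obtains a where "accumulation_point_of_seq T s a" "a \<in> core"
proof -
  obtain a where a: "accumulation_point_of_seq T s a"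
    using V_acc[OF assms] by blast
  have "a \<in> V m" for m
    using assms V_antimono by (intro mem_V_if_frequently_near[OF a, of "Suc m"]) blast
  then show thesis
    using that[OF a] by (auto simp: core_def)
qed

text \<open>Otherwise each \<open>V n\<close> has a point outside \<open>W\<close>. Such points
  accumulate in the core and hence in the open set \<open>W\<close>, which none of them
  meets.\<close>

lemma V_base_at_core:
  assumes "openin T W" "core \<subseteq> W"
  obtains n where "V n \<subseteq> W"
proof (rule ccontr)
  assume "\<not> thesis"
  then have "\<exists>x. x \<in> V n - W" for n
    using that by blast
  then obtain s where s: "\<And>n. s n \<in> V n - W"
    by metis
  then obtain a where a: "accumulation_point_of_seq T s a" "a \<in> core"
    using accumulation_point_in_core[of s] by blast
  then have "infinite {n. s n \<in> W}"
    using assms by (auto simp: accumulation_point_of_seq_def)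
  then show False
    using s by simp
qed

lemma V_base_at_l_coset:
  assumes "openin T W" "x \<in> carrier G" "\<And>h. h \<in> core \<Longrightarrow> x \<otimes> h \<in> W"
  obtains n where "\<And>v. v \<in> V n \<Longrightarrow> x \<otimes> v \<in> W"
proof -
  have "core \<subseteq> {y \<in> carrier G. x \<otimes> y \<in> W}"
    using assms(3) subgroup.subset[OF subgroup_core] by blast
  then obtain n where "V n \<subseteq> {y \<in> carrier G. x \<otimes> y \<in> W}"
    using V_base_at_core[OF openin_left_translate[OF assms(1,2)]] by blast
  then show thesis
    using that by blast
qed

lemma countable_character_core: "countable_character_in T core"
  unfolding countable_character_in_def
proof (intro conjI exI[of _ V] allI impI)
  show "core \<subseteq> topspace T"
    using subgroup.subset[OF subgroup_core] topspace_eq by simp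
  show "\<exists>n. V n \<subseteq> W" if "openin T W \<and> core \<subseteq> W" for W
    using V_base_at_core[of W] that by blast
qed (fact V_open core_subset)+

text \<open>A sequence in the core selects from every \<open>V n\<close> and thus accumulates in the
  core; translation handles the coset of \<open>x\<close>. The coset is written in the form in which
  fibres of the quotient map arise.\<close>

lemma countably_compactin_l_coset:
  assumes x: "x \<in> carrier G"
  shows "countably_compactin T {y \<in> carrier G. inv x \<otimes> y \<in> core}"
proof (rule countably_compactin_if_accumulation_points)
  fix s :: "nat \<Rightarrow> 'a" assume "range s \<subseteq> {y \<in> carrier G. inv x \<otimes> y \<in> core}"
  then have s: "\<And>n. s n \<in> carrier G" "\<And>n. inv x \<otimes> s n \<in> core"
    by auto
  then obtain a where a: "accumulation_point_of_seq T (\<lambda>n. inv x \<otimes> s n) a" "a \<in> core"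
    using accumulation_point_in_core[of "\<lambda>n. inv x \<otimes> s n"] core_subset by blast
  have "a \<in> carrier G"
    using a(2) subgroup.subset[OF subgroup_core] by blast
  then have "inv x \<otimes> (x \<otimes> a) \<in> core"
    using a(2) x by (simp add: m_assoc[symmetric])
  then show "\<exists>b\<in>{y \<in> carrier G. inv x \<otimes> y \<in> core}. accumulation_point_of_seq T s b"
    using accumulation_point_translate[OF x s(1) a(1)] x \<open>a \<in> carrier G\<close> by blast
qed (auto simp: topspace_eq)

lemma countably_compactin_core: "countably_compactin T core"
proof -
  have "{y \<in> carrier G. inv \<one> \<otimes> y \<in> core} = core"
    using subgroup.subset[OF subgroup_core] by auto
  then show ?thesis
    using countably_compactin_l_coset[of \<one>] by simp
qed

text \<open>It suffices that \<open>E\<close>, the complement of the saturation of \<open>F\<close>,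
  is open. For \<open>y\<close> in \<open>E\<close> the coset of \<open>y\<close> avoids
  \<open>F\<close>, and by the base property so does a whole translate of some
  \<open>V n\<close>.\<close>

lemma closed_map_coset: "closed_map T (coset_topology G T core) (\<lambda>x. x <# core)"
  unfolding closed_map_def
proof (intro allI impI)
  let ?p = "\<lambda>x. x <# core"
  fix F assume F: "closedin T F"
  then have FG: "F \<subseteq> carrier G"
    using closedin_subset topspace_eq by blast
  define E where "E = {x \<in> carrier G. ?p x \<notin> ?p ` F}"
  have "openin T E"
  proof (subst openin_subopen, intro ballI)
    fix y assume y: "y \<in> E"
    then have yG: "y \<in> carrier G"
      by (simp add: E_def)
    have "y \<otimes> h \<in> carrier G - F" if "h \<in> core" for h
    proof -
      have "h \<in> carrier G"
        using that subgroup.subset[OF subgroup_core] by blast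
      then have "?p y = ?p (y \<otimes> h)"
        using yG that by (subst l_coset_eq_iff[OF subgroup_core]) (auto simp: m_assoc[symmetric])
      then show ?thesis
        using y yG \<open>h \<in> carrier G\<close> by (auto simp: E_def)
    qed
    moreover have "openin T (carrier G - F)"
      using F by (metis openin_closedin_eq closedin_def topspace_eq)
    ultimately obtain n where n: "\<And>v. v \<in> V n \<Longrightarrow> y \<otimes> v \<in> carrier G - F"
      using V_base_at_l_coset[OF _ yG] by blast
    \<comment> \<open>One level deeper there is room for a further factor from the core: a point
      \<open>f\<close> of \<open>F\<close> in the coset of \<open>z\<close> is \<open>y\<close>
      times \<open>inv y \<otimes> z\<close> times \<open>inv z \<otimes> f\<close>, which would lie
      in the translate of \<open>V n\<close>.\<close>
    define N where "N = {z \<in> carrier G. inv y \<otimes> z \<in> V (Suc n)}"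
    have "openin T N" "y \<in> N"
      using yG V_open V_one by (auto simp: N_def intro: openin_left_translate)
    moreover have "N \<subseteq> E"
    proof
      fix z assume z: "z \<in> N"
      then have zG: "z \<in> carrier G"
        by (simp add: N_def)
      have False if "f \<in> F" "?p z = ?p f" for f
      proof -
        have fG: "f \<in> carrier G"
          using that FG by blast
        have "inv z \<otimes> f \<in> core"
          using that zG fG l_coset_eq_iff[OF subgroup_core] by blast
        then have "(inv y \<otimes> z) \<otimes> (inv z \<otimes> f) \<in> V n"
          using z core_subset by (auto simp: N_def intro!: V_mult[of "inv y \<otimes> z"])
        then have "y \<otimes> ((inv y \<otimes> z) \<otimes> (inv z \<otimes> f)) \<in> carrier G - F"
          by (rule n)
        moreover have "y \<otimes> ((inv y \<otimes> z) \<otimes> (inv z \<otimes> f)) = f"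
          using yG zG fG by (simp add: m_assoc mult_inv_cancel)
        ultimately show False
          using that by simp
      qed
      then show "z \<in> E"
        using zG by (auto simp: E_def)
    qed
    ultimately show "\<exists>N. openin T N \<and> y \<in> N \<and> N \<subseteq> E"
      by blast
  qed
  moreover have "{x \<in> topspace T. ?p x \<in> lcosets core - ?p ` F} = E"
    by (auto simp: E_def topspace_eq LCOSETS_def)
  ultimately have "openin (coset_topology G T core) (lcosets core - ?p ` F)"
    unfolding coset_topology_def openin_quotient_topology
    by (auto simp: topspace_eq LCOSETS_def)
  then show "closedin (coset_topology G T core) (?p ` F)"
    using FG by (auto simp: closedin_def topspace_coset_topology LCOSETS_def)
qed

lemma quasi_perfect_map_coset: "quasi_perfect_map T (coset_topology G T core) (\<lambda>x. x <# core)"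
  unfolding quasi_perfect_map_def
proof (intro conjI ballI closed_map_coset)
  show "continuous_map T (coset_topology G T core) (\<lambda>x. x <# core)"
    unfolding coset_topology_def
    by (rule quotient_imp_continuous_map[OF quotient_map_quotient_topology])
  fix A assume "A \<in> topspace (coset_topology G T core)"
  then obtain x where x: "x \<in> carrier G" "A = x <# core"
    by (auto simp: topspace_coset_topology LCOSETS_def)
  then have "{y \<in> topspace T. y <# core = A} = {y \<in> carrier G. inv x \<otimes> y \<in> core}"
    using l_coset_eq_iff[OF subgroup_core] by (auto simp: topspace_eq)
  then show "countably_compactin T {y \<in> topspace T. y <# core = A}"
    using countably_compactin_l_coset[OF x(1)] by simp
qed

text \<open>The relations \<open>inv x \<otimes> y \<in> V n\<close> yield a pseudometric on the
  group that vanishes exactly on pairs in the same coset, so it descends to a metric on the cosets.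
  The base property of \<open>V\<close> identifies the two topologies.\<close>

lemma metrizable_coset_topology: "metrizable_space (coset_topology G T core)"
proof -
  let ?p = "\<lambda>x. x <# core"
  \<comment> \<open>The diagonal is added because \<open>pseudometric_of_relations\<close> demands
    reflexivity on the whole type, also outside the carrier.\<close>
  define R where "R n = {(x, y). x = y \<or> x \<in> carrier G \<and> y \<in> carrier G \<and> inv x \<otimes> y \<in> V n}" for n
  have R_iff: "(x, y) \<in> R n \<longleftrightarrow> inv x \<otimes> y \<in> V n" if "x \<in> carrier G" "y \<in> carrier G" for x y n
    using that V_one by (auto simp: R_def)
  have "sym (R n)" for n
  proof (rule symI)
    fix x y assume xy: "(x, y) \<in> R n"
    show "(y, x) \<in> R n"
    proof (cases "x = y")
      case False
      then have "x \<in> carrier G" "y \<in> carrier G" "inv (inv x \<otimes> y) \<in> V n"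
        using xy V_inv by (auto simp: R_def)
      then show ?thesis
        by (auto simp: R_def inv_mult_group)
    qed (simp add: R_def)
  qed
  moreover have "R (Suc n) O R (Suc n) O R (Suc n) \<subseteq> R n" for n
  proof clarify
    fix x y z w assume R: "(x, y) \<in> R (Suc n)" "(y, z) \<in> R (Suc n)" "(z, w) \<in> R (Suc n)"
    show "(x, w) \<in> R n"
    proof (cases "x \<in> carrier G")
      case True
      then have carr: "x \<in> carrier G" "y \<in> carrier G" "z \<in> carrier G" "w \<in> carrier G"
        using R by (auto simp: R_def)
      then have "(inv x \<otimes> y) \<otimes> (inv y \<otimes> z) \<otimes> (inv z \<otimes> w) \<in> V n"
        using R by (intro V_mult3) (auto simp: R_iff)
      moreover have "(inv x \<otimes> y) \<otimes> (inv y \<otimes> z) \<otimes> (inv z \<otimes> w) = inv x \<otimes> w"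
        using carr by (simp add: m_assoc mult_inv_cancel)
      ultimately show ?thesis
        using carr by (simp add: R_iff)
    qed (use R in \<open>auto simp: R_def\<close>)
  qed
  moreover have "Id \<subseteq> R n" for n
    by (auto simp: R_def)
  ultimately obtain d :: "'a \<Rightarrow> 'a \<Rightarrow> real" where d: "\<And>x y. 0 \<le> d x y" "\<And>x. d x x = 0"
      "\<And>x y. d x y = d y x" "\<And>x y z. d x z \<le> d x y + d y z"
    and d_less: "\<And>n x y. (x, y) \<in> R n \<Longrightarrow> d x y < (1/2) ^ n"
    and less_d: "\<And>n x y. d x y < (1/2) ^ Suc n \<Longrightarrow> (x, y) \<in> R n"
    using pseudometric_of_relations[of R] by metis
  have half_power: "\<exists>n. (1/2::real) ^ n < r" if "0 < r" for r
    using that by (intro real_arch_pow_inv) auto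
  have d_zero_iff: "d x y = 0 \<longleftrightarrow> ?p x = ?p y" if "x \<in> carrier G" "y \<in> carrier G" for x y
  proof -
    have "d x y = 0 \<longleftrightarrow> (\<forall>n. (x, y) \<in> R n)"
    proof
      assume *: "\<forall>n. (x, y) \<in> R n"
      have "\<not> 0 < d x y"
        using half_power[of "d x y"] d_less * by (meson less_asym)
      then show "d x y = 0"
        using d(1)[of x y] by simp
    qed (use less_d in simp)
    then show ?thesis
      unfolding l_coset_eq_iff[OF subgroup_core that] by (simp add: R_iff[OF that] core_def)
  qed

  \<comment> \<open>Distances between cosets are measured at chosen representatives; the choice is
    immaterial because points of one coset have distance zero.\<close>
  define rep where "rep A = (SOME x. x \<in> carrier G \<and> ?p x = A)" for A
  have rep: "rep A \<in> carrier G \<and> ?p (rep A) = A" if "A \<in> lcosets core" for A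
  proof -
    have "\<exists>x. x \<in> carrier G \<and> ?p x = A"
      using that by (auto simp: LCOSETS_def)
    then show ?thesis
      unfolding rep_def by (rule someI_ex)
  qed
  define D where "D A B = d (rep A) (rep B)" for A B
  have D: "D (?p x) (?p y) = d x y" if xy: "x \<in> carrier G" "y \<in> carrier G" for x y
  proof -
    have zero: "d z (rep (?p z)) = 0" if z: "z \<in> carrier G" for z
    proof -
      have "?p z \<in> lcosets core"
        using z by (auto simp: LCOSETS_def)
      then show ?thesis
        using rep[of "?p z"] d_zero_iff[OF z, of "rep (?p z)"] by simp
    qed
    let ?x = "rep (?p x)" and ?y = "rep (?p y)"
    have "d ?x ?y \<le> d ?x x + (d x y + d y ?y)" "d x y \<le> d x ?x + (d ?x ?y + d ?y y)"
      using d(4)[of ?x ?y x] d(4)[of x ?y y] d(4)[of x y ?x] d(4)[of ?x y ?y] by simp_all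
    then show ?thesis
      using zero[OF xy(1)] zero[OF xy(2)] d(3)[of ?x x] d(3)[of ?y y] by (simp add: D_def)
  qed
  interpret Metric_space "lcosets core" D
  proof
    show "D A B = 0 \<longleftrightarrow> A = B" if "A \<in> lcosets core" "B \<in> lcosets core" for A B
      using rep[OF that(1)] rep[OF that(2)] d_zero_iff unfolding D_def by metis
  qed (auto simp: D_def d)
  have "openin mtopology U \<longleftrightarrow> openin (coset_topology G T core) U" for U
  proof (cases "U \<subseteq> lcosets core")
    case True
    \<comment> \<open>Both notions of openness are compared through the preimage \<open>P\<close> of
      \<open>U\<close> in the group.\<close>
    define P where "P = {x \<in> carrier G. ?p x \<in> U}"
    have "openin mtopology U \<longleftrightarrow> (\<forall>A\<in>U. \<exists>r>0. mball A r \<subseteq> U)"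
      using True by (auto simp: openin_mtopology)
    also have "\<dots> \<longleftrightarrow> (\<forall>x\<in>P. \<exists>r>0. mball (?p x) r \<subseteq> U)"
      using True by (auto simp: P_def LCOSETS_def)
    also have "\<dots> \<longleftrightarrow> (\<forall>x\<in>P. \<exists>r>0. \<forall>y\<in>carrier G. d x y < r \<longrightarrow> y \<in> P)"
    proof -
      have "mball (?p x) r \<subseteq> U \<longleftrightarrow> (\<forall>y\<in>carrier G. d x y < r \<longrightarrow> y \<in> P)" if "x \<in> P" for x r
      proof -
        have lcosets_iff: "A \<in> lcosets core \<longleftrightarrow> (\<exists>y\<in>carrier G. A = ?p y)" for A
          by (auto simp: LCOSETS_def)
        have xG: "x \<in> carrier G"
          using that by (simp add: P_def)
        have "A \<in> mball (?p x) r \<longleftrightarrow> (\<exists>y\<in>carrier G. A = ?p y \<and> d x y < r)" for A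
          unfolding in_mball lcosets_iff using xG D[OF xG] by auto
        then show ?thesis
          by (auto simp: P_def subset_iff)
      qed
      then show ?thesis by simp
    qed
    also have "\<dots> \<longleftrightarrow> openin T P"
    proof
      assume *: "\<forall>x\<in>P. \<exists>r>0. \<forall>y\<in>carrier G. d x y < r \<longrightarrow> y \<in> P"
      show "openin T P"
      proof (subst openin_subopen, intro ballI)
        fix x assume x: "x \<in> P"
        then obtain r where r: "0 < r" "\<forall>y\<in>carrier G. d x y < r \<longrightarrow> y \<in> P"
          using * by blast
        obtain n where n: "(1/2::real) ^ n < r"
          using half_power[OF r(1)] by blast
        have xG: "x \<in> carrier G"
          using x by (simp add: P_def)
        define N where "N = {y \<in> carrier G. inv x \<otimes> y \<in> V n}"
        have "openin T N" "x \<in> N"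
          using xG V_open V_one by (auto simp: N_def intro: openin_left_translate)
        moreover have "N \<subseteq> P"
        proof
          fix y assume "y \<in> N"
          then have y: "y \<in> carrier G" "(x, y) \<in> R n"
            using xG by (simp_all add: N_def R_iff)
          then have "d x y < r"
            using d_less[of x y n] n by linarith
          then show "y \<in> P"
            using r(2) y(1) by blast
        qed
        ultimately show "\<exists>N. openin T N \<and> x \<in> N \<and> N \<subseteq> P"
          by blast
      qed
    next
      assume P: "openin T P"
      show "\<forall>x\<in>P. \<exists>r>0. \<forall>y\<in>carrier G. d x y < r \<longrightarrow> y \<in> P"
      proof
        fix x assume x: "x \<in> P"
        then have xG: "x \<in> carrier G"
          by (simp add: P_def)
        \<comment> \<open>\<open>P\<close> is a union of cosets, so it contains the coset of
          \<open>x\<close>, hence a translate of some \<open>V n\<close>, hence the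
          \<open>d\<close>-ball of radius \<open>(1/2) ^ Suc n\<close> within the carrier.\<close>
        have "x \<otimes> h \<in> P" if "h \<in> core" for h
        proof -
          have h: "h \<in> carrier G"
            using that subgroup.subset[OF subgroup_core] by blast
          then have "?p x = ?p (x \<otimes> h)"
            using xG that by (subst l_coset_eq_iff[OF subgroup_core]) (auto simp: m_assoc[symmetric])
          then show ?thesis
            using x h by (auto simp: P_def)
        qed
        then obtain n where n: "\<And>v. v \<in> V n \<Longrightarrow> x \<otimes> v \<in> P"
          using V_base_at_l_coset[OF P xG] by blast
        have "y \<in> P" if y: "y \<in> carrier G" "d x y < (1/2) ^ Suc n" for y
        proof -
          have "x \<otimes> (inv x \<otimes> y) \<in> P"
            using less_d[OF y(2)] n xG y(1) by (simp add: R_iff)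
          then show ?thesis
            using xG y(1) by (simp add: m_assoc[symmetric])
        qed
        then show "\<exists>r>0. \<forall>y\<in>carrier G. d x y < r \<longrightarrow> y \<in> P"
          by (intro exI[of _ "(1/2) ^ Suc n"]) auto
      qed
    qed
    also have "\<dots> \<longleftrightarrow> openin (coset_topology G T core) U"
      using True
      by (auto simp: coset_topology_def openin_quotient_topology topspace_eq P_def LCOSETS_def)
    finally show ?thesis .
  next
    case False
    then show ?thesis
      using openin_subset[of mtopology U] openin_subset[of "coset_topology G T core" U]
      by (auto simp: topspace_coset_topology)
  qed
  then have "mtopology = coset_topology G T core"
    by (simp add: topology_eq)
  then show ?thesis
    using metrizable_space_mtopology by simp
qed

end


section \<open>The characterisation\<close>

context topological_group
begin

text \<open>By normality \<open>H\<close> lies in the preimage of \<open>W\<close> under conjugation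
  by any \<open>x\<close>. That preimage is open, so a single countable base at \<open>H\<close>
  serves all \<open>x\<close> at once.\<close>

lemma omega_balanced_if_normal_countable_character:
  assumes "\<And>W. openin T W \<Longrightarrow> \<one> \<in> W \<Longrightarrow>
    \<exists>H. H \<lhd> G \<and> countable_character_in T H \<and> H \<subseteq> W"
  shows "omega_balanced G T"
  unfolding omega_balanced_def
proof (intro allI impI)
  fix U assume "\<exists>W. openin T W \<and> \<one> \<in> W \<and> W \<subseteq> U"
  then obtain W where W: "openin T W" "\<one> \<in> W" "W \<subseteq> U"
    by blast
  then obtain H where H: "H \<lhd> G" "countable_character_in T H" "H \<subseteq> W"
    using assms by blast
  obtain B :: "nat \<Rightarrow> 'a set" where B: "\<And>n. openin T (B n)" "\<And>n. H \<subseteq> B n"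
    and base: "\<And>W. openin T W \<Longrightarrow> H \<subseteq> W \<Longrightarrow> \<exists>n. B n \<subseteq> W"
    by (rule countable_character_inE[OF H(2)]) blast
  have "\<exists>V\<in>range B. (x <# V) #> inv x \<subseteq> U" if x: "x \<in> carrier G" for x
  proof -
    have "H \<subseteq> {y \<in> carrier G. x \<otimes> y \<otimes> inv x \<in> W}"
      using normal_invE[OF H(1)] subgroup.subset x H(3) by blast
    then obtain n where "B n \<subseteq> {y \<in> carrier G. x \<otimes> y \<otimes> inv x \<in> W}"
      using base openin_conjugate[OF W(1) x] by blast
    then have "(x <# B n) #> inv x \<subseteq> U"
      using W(3) by (auto simp: l_coset_def r_coset_def)
    then show ?thesis by blast
  qed
  moreover have "\<one> \<in> H"
    using normal_invE(1)[OF H(1)] by (rule subgroup.one_closed)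
  ultimately show "\<exists>\<gamma>. countable \<gamma> \<and> (\<forall>V\<in>\<gamma>. openin T V \<and> \<one> \<in> V) \<and>
      (\<forall>x\<in>carrier G. \<exists>V\<in>\<gamma>. (x <# V) #> inv x \<subseteq> U)"
    using B by (intro exI[of _ "range B"]) blast
qed

lemma omega_balancedE:
  assumes "omega_balanced G T" "openin T U" "\<one> \<in> U"
  obtains g :: "nat \<Rightarrow> 'a set" where "\<And>k. openin T (g k)" "\<And>k. \<one> \<in> g k"
    "\<And>x. x \<in> carrier G \<Longrightarrow> \<exists>k. \<forall>v\<in>g k. x \<otimes> v \<otimes> inv x \<in> U"
proof -
  obtain \<gamma> where \<gamma>: "countable \<gamma>" "\<And>V. V \<in> \<gamma> \<Longrightarrow> openin T V \<and> \<one> \<in> V"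
      "\<And>x. x \<in> carrier G \<Longrightarrow> \<exists>V\<in>\<gamma>. (x <# V) #> inv x \<subseteq> U"
    using assms(1)[unfolded omega_balanced_def, rule_format, OF openin_subset_carrier[OF assms(2)]]
      assms(2,3) by blast
  \<comment> \<open>Non-emptiness allows an enumeration by all natural numbers, possibly with
    repetitions.\<close>
  have "\<gamma> \<noteq> {}"
    using \<gamma>(3)[of \<one>] by auto
  then have range: "range (from_nat_into \<gamma>) = \<gamma>"
    using \<gamma>(1) by (rule range_from_nat_into)
  show thesis
  proof
    show "openin T (from_nat_into \<gamma> k)" "\<one> \<in> from_nat_into \<gamma> k" for k
      using \<gamma>(2) \<open>\<gamma> \<noteq> {}\<close> by (auto intro: from_nat_into)
    show "\<exists>k. \<forall>v\<in>from_nat_into \<gamma> k. x \<otimes> v \<otimes> inv x \<in> U" if x: "x \<in> carrier G" for x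
    proof -
      obtain V where V: "V \<in> \<gamma>" "(x <# V) #> inv x \<subseteq> U"
        using \<gamma>(3)[OF x] by blast
      then obtain k where "V = from_nat_into \<gamma> k"
        using range by blast
      then show ?thesis
        using V(2) by (intro exI[of _ k]) (auto simp: l_coset_def r_coset_def)
    qed
  qed
qed

end

section \<open>Diagonal construction of the neighbourhood sequence\<close>

text \<open>The set \<open>V n\<close> has to respect all \<open>V i\<close> and \<open>g (V i) j\<close> with \<open>i, j < n\<close>,
  so that every pair \<open>(i, j)\<close> is taken care of eventually.\<close>

function diagonal_sequence ::
  "('a set \<Rightarrow> 'a set) \<Rightarrow> ('a set \<Rightarrow> nat \<Rightarrow> 'a set) \<Rightarrow> (nat \<Rightarrow> 'a set) \<Rightarrow> nat \<Rightarrow> 'a set" where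
  "diagonal_sequence c g B n =
     c (B n \<inter> (\<Inter>i\<in>{..<n}. diagonal_sequence c g B i \<inter>
                  (\<Inter>j<n. g (diagonal_sequence c g B i) j)))"
  by auto
termination
  by (relation "Wellfounded.measure (\<lambda>(c, g, B, n). n)") auto

declare diagonal_sequence.simps [simp del]

context topological_group
begin

text \<open>Here \<open>c U\<close> is a symmetric neighbourhood with cube inside \<open>U\<close>,
  and every \<open>x\<close> conjugates some \<open>g U k\<close> into \<open>U\<close>. The
  diagonal sequence puts the core inside every \<open>g (V n) k\<close>, so each conjugate of a core
  element lies in every \<open>V n\<close>.\<close>

lemma normal_q_neighbourhood_sequence:
  assumes "omega_balanced G T" "q_space T" "openin T W" "\<one> \<in> W"
  obtains V where "q_neighbourhood_sequence G T V" "\<And>n. V n \<subseteq> W"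
    "neighbourhood_sequence.core V \<lhd> G"
proof -
  obtain B where B: "\<And>n. openin T (B n)" "\<And>n. \<one> \<in> B n"
    and acc: "\<And>s. \<forall>n. s n \<in> B n \<Longrightarrow> \<exists>a. accumulation_point_of_seq T s a"
    using assms(2) unfolding q_space_iff_q_point_one q_point_def by blast
  define nbhd where "nbhd U \<longleftrightarrow> openin T U \<and> \<one> \<in> U" for U
  \<comment> \<open>Stating this as an implication makes it true for every set, so that choice
    provides a total function \<open>c\<close>; the same is done for \<open>g\<close>.\<close>
  have "\<exists>C. nbhd U \<longrightarrow> nbhd C \<and> (\<forall>x\<in>C. inv x \<in> C) \<and>
      (\<forall>x\<in>C. \<forall>y\<in>C. \<forall>z\<in>C. x \<otimes> y \<otimes> z \<in> U)" for U
  proof (cases "nbhd U")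
    case True
    then obtain C where "openin T C" "\<one> \<in> C" "\<And>x. x \<in> C \<Longrightarrow> inv x \<in> C"
      "\<And>x y z. x \<in> C \<Longrightarrow> y \<in> C \<Longrightarrow> z \<in> C \<Longrightarrow> x \<otimes> y \<otimes> z \<in> U"
      using symmetric_cube_neighbourhood[of U] unfolding nbhd_def by blast
    then show ?thesis
      unfolding nbhd_def by blast
  qed simp
  then obtain c where "\<forall>U. nbhd U \<longrightarrow> nbhd (c U) \<and> (\<forall>x\<in>c U. inv x \<in> c U) \<and>
      (\<forall>x\<in>c U. \<forall>y\<in>c U. \<forall>z\<in>c U. x \<otimes> y \<otimes> z \<in> U)"
    using choice[of "\<lambda>U C. nbhd U \<longrightarrow> nbhd C \<and> (\<forall>x\<in>C. inv x \<in> C) \<and>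
      (\<forall>x\<in>C. \<forall>y\<in>C. \<forall>z\<in>C. x \<otimes> y \<otimes> z \<in> U)"] by blast
  then have c: "\<And>U. nbhd U \<Longrightarrow> nbhd (c U)" "\<And>U x. nbhd U \<Longrightarrow> x \<in> c U \<Longrightarrow> inv x \<in> c U"
    "\<And>U x y z. \<lbrakk>nbhd U; x \<in> c U; y \<in> c U; z \<in> c U\<rbrakk> \<Longrightarrow> x \<otimes> y \<otimes> z \<in> U"
    by auto
  have "\<exists>g. nbhd U \<longrightarrow> (\<forall>k::nat. nbhd (g k)) \<and>
      (\<forall>x\<in>carrier G. \<exists>k. \<forall>v\<in>g k. x \<otimes> v \<otimes> inv x \<in> U)" for U
  proof (cases "nbhd U")
    case True
    then obtain g :: "nat \<Rightarrow> 'a set" where "\<And>k. openin T (g k)" "\<And>k. \<one> \<in> g k"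
      "\<And>x. x \<in> carrier G \<Longrightarrow> \<exists>k. \<forall>v\<in>g k. x \<otimes> v \<otimes> inv x \<in> U"
      using omega_balancedE[OF assms(1), of U] unfolding nbhd_def by blast
    then show ?thesis
      unfolding nbhd_def by blast
  qed simp
  then obtain g :: "'a set \<Rightarrow> nat \<Rightarrow> 'a set" where "\<forall>U. nbhd U \<longrightarrow> (\<forall>k. nbhd (g U k)) \<and>
      (\<forall>x\<in>carrier G. \<exists>k. \<forall>v\<in>g U k. x \<otimes> v \<otimes> inv x \<in> U)"
    using choice[of "\<lambda>U g. nbhd U \<longrightarrow> (\<forall>k::nat. nbhd (g k)) \<and>
      (\<forall>x\<in>carrier G. \<exists>k. \<forall>v\<in>g k. x \<otimes> v \<otimes> inv x \<in> U)"] by blast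
  then have g: "\<And>U k. nbhd U \<Longrightarrow> nbhd (g U k)"
    "\<And>U x. nbhd U \<Longrightarrow> x \<in> carrier G \<Longrightarrow> \<exists>k. \<forall>v\<in>g U k. x \<otimes> v \<otimes> inv x \<in> U"
    by auto
  define V where "V = diagonal_sequence c g (\<lambda>n. B n \<inter> W)"
  define X where "X n = (B n \<inter> W) \<inter> (\<Inter>i\<in>{..<n}. V i \<inter> (\<Inter>j<n. g (V i) j))" for n
  have V_eq: "V n = c (X n)" for n
    unfolding V_def X_def by (subst diagonal_sequence.simps) simp
  have X: "nbhd (X n)" for n
  proof (induction n rule: less_induct)
    case (less n)
    have V: "nbhd (V i)" if "i < n" for i
      using less[OF that] c(1) V_eq by simp
    have "nbhd (V i \<inter> (\<Inter>j<n. g (V i) j))" if "i < n" for i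
      using V[OF that] g(1)[OF V[OF that]] that by (auto simp: nbhd_def intro!: openin_Int openin_INT2)
    \<comment> \<open>For \<open>n = 0\<close> the intersection over no indices is the whole type,
      which need not be open in \<open>T\<close>; that stage is treated separately.\<close>
    then have *: "nbhd (\<Inter>i\<in>{..<n}. V i \<inter> (\<Inter>j<n. g (V i) j))" if "n \<noteq> 0"
      using that by (auto simp: nbhd_def intro!: openin_INT2)
    show ?case
    proof (cases "n = 0")
      case True
      then show ?thesis
        using B assms(3,4) by (auto simp: X_def nbhd_def)
    next
      case False
      then show ?thesis
        using B assms(3,4) * by (auto simp: X_def nbhd_def)
    qed
  qed
  then have V: "nbhd (V n)" for n
    using c(1) V_eq by simp
  \<comment> \<open>Padding with the identity writes \<open>x\<close> as a triple product of
    elements of \<open>c (X n)\<close>, which lies in \<open>X n\<close>.\<close>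
  have V_sub: "V n \<subseteq> X n" for n
  proof
    fix x assume x: "x \<in> V n"
    have "\<one> \<in> V n" "x \<in> carrier G"
      using V[of n] x openin_subset_carrier by (auto simp: nbhd_def)
    then show "x \<in> X n"
      using c(3)[OF X, of x n \<one> \<one>] x by (simp add: V_eq)
  qed
  have X_sub: "X n \<subseteq> V i" "X n \<subseteq> g (V i) j" if "i < n" "j < n" for i j n
    using that by (auto simp: X_def)
  interpret q_neighbourhood_sequence G T V
  proof
    show "openin T (V n)" "\<one> \<in> V n" for n
      using V by (auto simp: nbhd_def)
    show "inv x \<in> V n" if "x \<in> V n" for x n
      using that c(2)[OF X] by (simp add: V_eq)
    show "x \<otimes> y \<otimes> z \<in> V n" if "x \<in> V (Suc n)" "y \<in> V (Suc n)" "z \<in> V (Suc n)" for x y z n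
      using that c(3)[OF X, of x "Suc n" y z] X_sub(1)[of n "Suc n" n] by (auto simp: V_eq)
    show "\<exists>a. accumulation_point_of_seq T s a" if "\<forall>n. s n \<in> V n" for s
      using that V_sub by (intro acc) (force simp: X_def)
  qed
  have "core \<lhd> G"
  proof (rule normal_invI[OF subgroup_core])
    fix x h assume x: "x \<in> carrier G" and h: "h \<in> core"
    have "x \<otimes> h \<otimes> inv x \<in> V n" for n
    proof -
      obtain k where k: "\<forall>v\<in>g (V n) k. x \<otimes> v \<otimes> inv x \<in> V n"
        using g(2)[OF V x] by blast
      \<comment> \<open>The stage \<open>Suc (max n k)\<close> comes after both \<open>n\<close> and
        \<open>k\<close>, so its set has been placed inside \<open>g (V n) k\<close>.\<close>
      have "h \<in> g (V n) k"
        using h core_subset V_sub X_sub(2)[of n "Suc (max n k)" k] by fastforce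
      then show ?thesis
        using k by blast
    qed
    then show "x \<otimes> h \<otimes> inv x \<in> core"
      by (simp add: core_def)
  qed
  moreover have "V n \<subseteq> W" for n
    using V_sub by (auto simp: X_def)
  ultimately show thesis
    using that q_neighbourhood_sequence_axioms by blast
qed

end

theorem theorem2p3:
  fixes G :: "('a, 'b) monoid_scheme" and T :: "'a topology"
  assumes "topological_group G T"
    and "Hausdorff_space T"
  shows "omega_balanced G T \<and> q_space T \<longleftrightarrow>
    (\<forall>W. openin T W \<and> \<one>\<^bsub>G\<^esub> \<in> W \<longrightarrow>
      (\<exists>H. H \<lhd> G \<and> countably_compactin T H \<and> countable_character_in T H \<and> H \<subseteq> W \<and>
           quasi_perfect_map T (coset_topology G T H) (\<lambda>x. x <#\<^bsub>G\<^esub> H) \<and>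
           metrizable_space (coset_topology G T H)))"
    (is "?lhs \<longleftrightarrow> ?rhs")
proof -
  interpret topological_group G T
    by fact
  show ?thesis
  proof
    assume lhs: ?lhs
    show ?rhs
    proof (intro allI impI)
      fix W assume W: "openin T W \<and> \<one>\<^bsub>G\<^esub> \<in> W"
      obtain V where "q_neighbourhood_sequence G T V" and V_W: "\<And>n. V n \<subseteq> W"
        and normal: "neighbourhood_sequence.core V \<lhd> G"
        using normal_q_neighbourhood_sequence lhs W by metis
      then interpret q_neighbourhood_sequence G T V
        by blast
      show "\<exists>H. H \<lhd> G \<and> countably_compactin T H \<and> countable_character_in T H \<and> H \<subseteq> W \<and>
           quasi_perfect_map T (coset_topology G T H) (\<lambda>x. x <#\<^bsub>G\<^esub> H) \<and>
           metrizable_space (coset_topology G T H)"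
        using normal countably_compactin_core countable_character_core quasi_perfect_map_coset
          metrizable_coset_topology core_subset V_W by (intro exI[of _ core]) blast
    qed
  next
    assume rhs: ?rhs
    have "omega_balanced G T"
      by (rule omega_balanced_if_normal_countable_character) (use rhs in blast)
    \<comment> \<open>One subgroup suffices for the q-property, so the whole group is taken as the
      neighbourhood; the identity lies in the resulting \<open>H\<close>, and homogeneity covers the
      other points.\<close>
    moreover have "openin T (carrier G)"
      using openin_topspace[of T] topspace_eq by simp
    then obtain H where H: "H \<lhd> G" "countably_compactin T H" "countable_character_in T H"
      using rhs[rule_format, of "carrier G"] one_closed by blast
    have "\<one>\<^bsub>G\<^esub> \<in> H"
      using normal_invE(1)[OF H(1)] by (rule subgroup.one_closed)
    then have "q_space T"
      using q_point_of_countable_character[OF H(2,3)] q_space_iff_q_point_one by blast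
    ultimately show ?lhs
      by blast
  qed
qed

end
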